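(* Let $P(x)=\sum_{i=0}^n P_i x^i\in\mathbb C[x]^{m\times m}$ be a regular matrix polynomial of degree $n$, let $q$ be an integer with $0<q\le n$, and let $B_1(x),\ldots,B_q(x)$ and $W_1(x),\ldots,W_q(x)$ be matrix polynomials in $\mathbb C[x]^{m\times m}$. Let $C_i(x)=\prod_{j=1,\,j\neq i}^q B_j(x)$ and suppose that: 1. $P(x)=\prod_{i=1}^q B_i(x)+\sum_{i=1}^q W_i(x)C_i(x)$; 2. the polynomials $B_i(x)$ are regular, commute, i.e., $B_i(x)B_j(x)-B_j(x)B_i(x)=0$ for any $i,j$, and are pairwise right co-prime; 3. $\deg B_i(x)=d$ for $i=1,\ldots,q$, $n=dq$, and $\deg W_i(x)<\deg B_i(x)$ for $i=1,\ldots,q$; 4. the reversed polynomials $B_i^\#(x)=x^dB_i(x^{-1})$, $i=1,\ldots,q$, are pairwise right co-prime. Then the matrix polynomial $$A(x)=\operatorname{diag}(B_1(x),\ldots,B_q(x))+(e\otimes I_m)[W_1(x),\ldots,W_q(x)],\qquad e=(1,\ldots,1)^t\in\mathbb C^q,$$ is a strong $\ell$-ification of $P(x)$ (with $\ell=d=\deg A(x)$); that is, $A(x)$ is equivalent to $P(x)$ and $A^\#(x)$ is equivalent to $P^\#(x)$.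
   Context: $\mathbb C[x]^{m\times m}$ is the set of $m\times m$ matrix polynomials over $\mathbb C$; $P(x)=\sum_{i=0}^n P_ix^i$ has degree $n$ if $P_n\ne 0$ (the zero polynomial is regarded as having degree smaller than any nonnegative integer). A matrix polynomial is regular if its determinant is not identically zero, and unimodular if its determinant is a nonzero constant. Two matrix polynomials $B(x),B'(x)\in\mathbb C[x]^{m\times m}$ are right co-prime if there exist $\alpha(x),\beta(x)\in\mathbb C[x]^{m\times m}$ with $B(x)\alpha(x)+B'(x)\beta(x)=I_m$; "pairwise" refers to all pairs with distinct indices. $\operatorname{diag}(B_1,\ldots,B_q)$ is block diagonal. The reversed polynomial of a matrix polynomial $Q(x)$ is $Q^\#(x)=x^{\deg Q}Q(x^{-1})$; in particular $P^\#(x)=x^nP(x^{-1})$. For an integer $0<q\le n$, $Q(x)\in\mathbb C[x]^{qm\times qm}$ is equivalent to an $m\times m$ matrix polynomial $R(x)$ if there are unimodular $E(x),F(x)\in\mathbb C[x]^{qm\times qm}$ with $E(x)Q(x)F(x)=I_{m(q-1)}\oplus R(x)$, where $\oplus$ denotes the block diagonal sum. An $\ell$-ification of $P$ is a matrix polynomial of degree $\ell$ equivalent to $P$; it is strong if moreover its reversed polynomial is equivalent to $P^\#$. *)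

theory Defs
  imports "HOL-Computational_Algebra.Polynomial" "Jordan_Normal_Form.Determinant"
begin

text \<open>
  A matrix polynomial is a matrix with polynomial entries. Its coefficient at x^i, a
  complex matrix, collects the i-th coefficients of the entries.
\<close>

type_synonym mat_poly = "complex poly mat"

definition mcoeff :: "mat_poly \<Rightarrow> nat \<Rightarrow> complex mat" where
  "mcoeff Q i = map_mat (\<lambda>p. coeff p i) Q"

text \<open>
  The degree is integer-valued, so that the zero matrix polynomial can be given degree -1,
  which is smaller than every nonnegative integer.
\<close>

definition mdegree :: "mat_poly \<Rightarrow> int" where
  "mdegree Q = (if Q = 0\<^sub>m (dim_row Q) (dim_col Q) then -1
     else int (GREATEST i. mcoeff Q i \<noteq> 0\<^sub>m (dim_row Q) (dim_col Q)))"

text \<open>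
  The reversed polynomial x^k Q(1/x) with k = deg Q, written out on coefficients; see
  \<open>poly_mreversed\<close> below. The library function \<open>reflect_poly\<close> is not suitable entrywise, as
  it reverses every entry with respect to the degree of that entry.
\<close>

definition mreversed :: "mat_poly \<Rightarrow> mat_poly" where
  "mreversed Q = (let k = nat (mdegree Q) in
     map_mat (\<lambda>p. \<Sum>i\<le>k. monom (coeff p i) (k - i)) Q)"

definition mregular :: "mat_poly \<Rightarrow> bool" where
  "mregular Q \<longleftrightarrow> det Q \<noteq> 0"

definition munimodular :: "mat_poly \<Rightarrow> bool" where
  "munimodular Q \<longleftrightarrow> (\<exists>c. c \<noteq> 0 \<and> det Q = [:c:])"

definition right_coprime :: "nat \<Rightarrow> mat_poly \<Rightarrow> mat_poly \<Rightarrow> bool" where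
  "right_coprime m B B' \<longleftrightarrow>
     (\<exists>\<alpha>\<in>carrier_mat m m. \<exists>\<beta>\<in>carrier_mat m m. B * \<alpha> + B' * \<beta> = 1\<^sub>m m)"

definition mequivalent :: "nat \<Rightarrow> nat \<Rightarrow> mat_poly \<Rightarrow> mat_poly \<Rightarrow> bool" where
  "mequivalent m q Q R \<longleftrightarrow>
     Q \<in> carrier_mat (q * m) (q * m) \<and> R \<in> carrier_mat m m \<and>
     (\<exists>E\<in>carrier_mat (q * m) (q * m). \<exists>F\<in>carrier_mat (q * m) (q * m).
        munimodular E \<and> munimodular F \<and>
        E * Q * F = diag_block_mat [1\<^sub>m (m * (q - 1)), R])"

definition ell_ification :: "nat \<Rightarrow> nat \<Rightarrow> nat \<Rightarrow> mat_poly \<Rightarrow> mat_poly \<Rightarrow> bool" where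
  "ell_ification m q l A P \<longleftrightarrow> mdegree A = int l \<and> mequivalent m q A P"

definition strong_ell_ification :: "nat \<Rightarrow> nat \<Rightarrow> nat \<Rightarrow> mat_poly \<Rightarrow> mat_poly \<Rightarrow> bool" where
  "strong_ell_ification m q l A P \<longleftrightarrow>
     ell_ification m q l A P \<and> mequivalent m q (mreversed A) (mreversed P)"

text \<open>
  Matrices of unspecified size form no monoid type class, so sums and (ordered) products of
  lists of m-by-m matrices are folds.
\<close>

definition msum_list :: "nat \<Rightarrow> mat_poly list \<Rightarrow> mat_poly" where
  "msum_list m Qs = foldr (+) Qs (0\<^sub>m m m)"

definition mprod_list :: "nat \<Rightarrow> mat_poly list \<Rightarrow> mat_poly" where
  "mprod_list m Qs = foldr (*) Qs (1\<^sub>m m)"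

definition cofactor_prod :: "nat \<Rightarrow> nat \<Rightarrow> (nat \<Rightarrow> mat_poly) \<Rightarrow> nat \<Rightarrow> mat_poly" where
  "cofactor_prod m q B i = mprod_list m (map B (filter (\<lambda>j. j \<noteq> i) [1..<Suc q]))"

definition kronecker :: "'a :: times mat \<Rightarrow> 'a mat \<Rightarrow> 'a mat" where
  "kronecker X Y = mat (dim_row X * dim_row Y) (dim_col X * dim_col Y)
     (\<lambda>(i, j). X $$ (i div dim_row Y, j div dim_col Y) * Y $$ (i mod dim_row Y, j mod dim_col Y))"

definition ones_col :: "nat \<Rightarrow> mat_poly" where
  "ones_col q = mat q 1 (\<lambda>_. 1)"

text \<open>
  The block row [W 1, ..., W q]. Matrix columns are counted from 0 and blocks from 1, so
  column j lies in block j div m + 1.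
\<close>

definition block_row :: "nat \<Rightarrow> nat \<Rightarrow> (nat \<Rightarrow> mat_poly) \<Rightarrow> mat_poly" where
  "block_row m q W = mat m (q * m) (\<lambda>(i, j). W (j div m + 1) $$ (i, j mod m))"

definition A_poly :: "nat \<Rightarrow> nat \<Rightarrow> (nat \<Rightarrow> mat_poly) \<Rightarrow> (nat \<Rightarrow> mat_poly) \<Rightarrow> mat_poly" where
  "A_poly m q B W =
     diag_block_mat (map B [1..<Suc q]) + kronecker (ones_col q) (1\<^sub>m m) * block_row m q W"

lemma mcoeff_eq_0_above:
  assumes "mdegree Q < int i"
  shows "mcoeff Q i = 0\<^sub>m (dim_row Q) (dim_col Q)"
proof (cases "Q = 0\<^sub>m (dim_row Q) (dim_col Q)")
  case True
  show ?thesis by (subst True) (auto simp: mcoeff_def)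
next
  case False
  let ?P = "\<lambda>i. mcoeff Q i \<noteq> 0\<^sub>m (dim_row Q) (dim_col Q)"
  let ?D = "\<lambda>(r, c). degree (Q $$ (r, c))"
  define N where "N = (\<Sum>x\<in>{..<dim_row Q} \<times> {..<dim_col Q}. ?D x)"
  have bound: "k \<le> N" if k: "?P k" for k
  proof -
    obtain r c where rc: "r < dim_row Q" "c < dim_col Q" "coeff (Q $$ (r, c)) k \<noteq> 0"
      using k by (auto simp: mcoeff_def mat_eq_iff)
    have "k \<le> ?D (r, c)" using rc(3) by (auto intro: le_degree)
    also have "\<dots> \<le> N" unfolding N_def using rc(1,2) by (intro member_le_sum) auto
    finally show ?thesis .
  qed
  show ?thesis
  proof (rule ccontr)
    assume "\<not> ?thesis"
    then have "i \<le> Greatest ?P" using Greatest_le_nat[of ?P i N] bound by blast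
    then show False using assms False by (simp add: mdegree_def)
  qed
qed

lemma poly_mreversed:
  assumes "r < dim_row Q" "c < dim_col Q" "x \<noteq> 0"
  shows "poly (mreversed Q $$ (r, c)) x = x ^ nat (mdegree Q) * poly (Q $$ (r, c)) (1 / x)"
proof -
  define k where "k = nat (mdegree Q)"
  let ?p = "Q $$ (r, c)"
  have "coeff ?p i = 0" if "i > k" for i
  proof -
    have "mcoeff Q i $$ (r, c) = 0\<^sub>m (dim_row Q) (dim_col Q) $$ (r, c)"
      using that by (subst mcoeff_eq_0_above) (auto simp: k_def)
    then show ?thesis using assms by (simp add: mcoeff_def)
  qed
  then have "degree ?p \<le> k" by (simp add: degree_le)
  then have "poly ?p (1 / x) = (\<Sum>i\<le>k. coeff ?p i * (1 / x) ^ i)"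
    unfolding poly_altdef by (intro sum.mono_neutral_left) (auto simp: not_le coeff_eq_0)
  then have "x ^ k * poly ?p (1 / x) = (\<Sum>i\<le>k. coeff ?p i * x ^ (k - i))"
    using assms(3) by (auto simp: sum_distrib_left power_diff power_divide intro!: sum.cong)
  also have "\<dots> = poly (mreversed Q $$ (r, c)) x"
    using assms by (simp add: mreversed_def Let_def k_def poly_sum poly_monom)
  finally show ?thesis by (simp add: k_def)
qed

end

theory Submission
  imports Defs
begin

text \<open>Write \<open>D = diag (B 1, \<dots>, B q)\<close>, let \<open>e\<close> be the column of \<open>q\<close> identity blocks, \<open>W\<close> the block row
  of the \<open>W i\<close>, so that \<open>A = D + e W\<close>, and \<open>\<Pi>\<close> the product of the \<open>B i\<close>. The key is a matrix
  \<open>X\<close>, depending on the \<open>B i\<close> alone, with \<open>D X = diag (I, \<dots>, I, 0) + e T\<close> for some block row \<open>T\<close>.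

  Its last block column consists of the cofactors \<open>C i\<close>; since the \<open>B i\<close> commute,
  \<open>B i * C i = \<Pi>\<close> for every \<open>i\<close>, so the last block of \<open>T\<close> is \<open>\<Pi>\<close>. For \<open>k < q\<close> the \<open>k\<close>-th block
  column comes from a Chinese remainder argument (\<open>cofactor_column\<close>): pairwise right coprimeness
  makes \<open>B k\<close> right coprime to \<open>C k\<close>, say \<open>B k * a + C k * b = I\<close>, and \<open>T k = - C k * b\<close> is then
  divisible on the left by every \<open>B i\<close> with \<open>i \<noteq> k\<close>, while \<open>I + T k = B k * a\<close>.

  Consequently \<open>A X = diag (I, \<dots>, I, 0) + e (T + W X)\<close>. The last block of \<open>T + W X\<close> is
  \<open>\<Pi> + \<Sum> W i * C i = P\<close>, and unipotent row operations (\<open>stacked_row_elimination\<close>) turn the right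
  side into \<open>diag (I, \<dots>, I, P)\<close>. It remains to see that \<open>X\<close> is unimodular. The same
  identity for \<open>W = 0\<close> gives \<open>det D * det X = det \<Pi>\<close>, and \<open>det \<Pi>\<close> is the product of the
  \<open>det (B i)\<close>, that is \<open>det D\<close>, which is nonzero by regularity; so \<open>det X = 1\<close>. This is
  \<open>A_poly_equivalent\<close>, which holds for arbitrary \<open>W i\<close>.

  For the strong property the same lemma is applied to the reversed data. All \<open>B i\<close> have degree
  \<open>d\<close>, the \<open>W i\<close> have smaller degree and \<open>deg P = d * q\<close>, so reversing the \<open>B i\<close> and \<open>W i\<close> at
  degree \<open>d\<close> and \<open>P\<close> at degree \<open>d * q\<close> is compatible with sums and products: the reversals of
  \<open>A\<close> and \<open>P\<close> arise from the reversed \<open>B i\<close> and \<open>W i\<close> as \<open>A\<close> and \<open>P\<close> do from \<open>B i\<close> and \<open>W i\<close>.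
  Commutation and regularity pass to the reversals, and their coprimeness is assumed.\<close>

section \<open>Sums and products of lists of matrix polynomials\<close>

lemma mprod_list_simps [simp]:
  "mprod_list m [] = 1\<^sub>m m"
  "mprod_list m (Q # Qs) = Q * mprod_list m Qs"
  by (simp_all add: mprod_list_def)

lemma msum_list_simps [simp]:
  "msum_list m [] = 0\<^sub>m m m"
  "msum_list m (Q # Qs) = Q + msum_list m Qs"
  by (simp_all add: msum_list_def)

lemma mprod_list_carrier:
  "set Qs \<subseteq> carrier_mat m m \<Longrightarrow> mprod_list m Qs \<in> carrier_mat m m"
  by (induction Qs) auto

lemma msum_list_carrier:
  "set Qs \<subseteq> carrier_mat m m \<Longrightarrow> msum_list m Qs \<in> carrier_mat m m"
  by (induction Qs) auto

lemma det_mprod_list: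
  "set Qs \<subseteq> carrier_mat m m \<Longrightarrow> det (mprod_list m Qs) = prod_list (map det Qs)"
  by (induction Qs) (auto simp: det_mult[OF _ mprod_list_carrier])

lemma index_msum_list:
  assumes "\<forall>Q\<in>set Qs. Q \<in> carrier_mat m m" "i < m" "j < m"
  shows "msum_list m Qs $$ (i, j) = (\<Sum>Q\<leftarrow>Qs. Q $$ (i, j))"
  using assms(1)
proof (induction Qs)
  case (Cons Q Qs)
  then have "msum_list m Qs \<in> carrier_mat m m" by (intro msum_list_carrier) auto
  then show ?case using Cons assms(2,3) by simp
qed (simp add: assms(2,3))

text \<open>A factor that commutes with all the others can be moved to the front. This is how both
  \<open>B i * C i = \<Pi>\<close>, with \<open>\<Pi>\<close> the full product, and, for \<open>k \<noteq> i\<close>,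
  the left factor \<open>B k\<close> of \<open>C i\<close> are obtained.\<close>
lemma mprod_list_extract:
  assumes "distinct ks" "k \<in> set ks" "\<forall>i\<in>set ks. B i \<in> carrier_mat m m"
    and "\<forall>i\<in>set ks. B k * B i = B i * B k"
  shows "mprod_list m (map B ks) = B k * mprod_list m (map B (filter (\<lambda>i. i \<noteq> k) ks))"
  using assms
proof (induction ks)
  case (Cons i ks)
  define R where "R = mprod_list m (map B (filter (\<lambda>i. i \<noteq> k) ks))"
  have R: "R \<in> carrier_mat m m" unfolding R_def using Cons.prems by (intro mprod_list_carrier) auto
  show ?case
  proof (cases "i = k")
    case True
    then have "filter (\<lambda>i. i \<noteq> k) ks = ks" using Cons.prems(1) by (auto simp: filter_id_conv)
    then show ?thesis using True by simp
  next
    case False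
    have c: "B i \<in> carrier_mat m m" "B k \<in> carrier_mat m m" using Cons.prems by auto
    have "mprod_list m (map B (i # ks)) = B i * (B k * R)"
      using Cons.IH Cons.prems False by (simp add: R_def)
    also have "\<dots> = B k * B i * R"
      using assoc_mult_mat[OF c R] Cons.prems(4) by simp
    also have "\<dots> = B k * (B i * R)" using assoc_mult_mat[OF c(2,1) R] .
    finally show ?thesis using False by (simp add: R_def)
  qed
qed simp

section \<open>Right coprimeness to a product\<close>

lemma right_coprime_one:
  assumes "B \<in> carrier_mat m m"
  shows "right_coprime m B (1\<^sub>m m)"
  unfolding right_coprime_def using assms
  by (intro bexI[of _ "0\<^sub>m m m"] bexI[of _ "1\<^sub>m m"]) auto

text \<open>As in a commutative ring, multiply two Bezout identities: inserting
  \<open>C = C * (B * \<gamma> + D * \<delta>) = B * (C * \<gamma>) + C * D * \<delta>\<close> into \<open>B * \<alpha> + C * \<beta> = 1\<close>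
  leaves a right multiple of \<open>B\<close> and one of \<open>C * D\<close>. Only \<open>B\<close> and \<open>C\<close> are interchanged; the
  Bezout coefficients need not commute with anything and stay on the right.\<close>
lemma right_coprime_mult:
  assumes c: "B \<in> carrier_mat m m" "C \<in> carrier_mat m m" "D \<in> carrier_mat m m"
    and comm: "B * C = C * B"
    and BC: "right_coprime m B C" and BD: "right_coprime m B D"
  shows "right_coprime m B (C * D)"
proof -
  obtain \<alpha> \<beta> where 1: "\<alpha> \<in> carrier_mat m m" "\<beta> \<in> carrier_mat m m" "B * \<alpha> + C * \<beta> = 1\<^sub>m m"
    using BC unfolding right_coprime_def by auto
  obtain \<gamma> \<delta> where 2: "\<gamma> \<in> carrier_mat m m" "\<delta> \<in> carrier_mat m m" "B * \<gamma> + D * \<delta> = 1\<^sub>m m"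
    using BD unfolding right_coprime_def by auto
  note [simp] = c 1(1,2) 2(1,2) mult_add_distrib_mat[of _ m m _ m] add_mult_distrib_mat[of _ m m _ _ m]
    assoc_mult_mat[of _ m m _ m _ m] mult_carrier_mat[of _ m m _ m]
  have "C = C * (B * \<gamma> + D * \<delta>)" unfolding 2(3) right_mult_one_mat[OF c(2)] ..
  also have "\<dots> = C * (B * \<gamma>) + C * (D * \<delta>)" by simp
  also have "C * (B * \<gamma>) = B * (C * \<gamma>)"
    using comm assoc_mult_mat[of C m m B m \<gamma> m] assoc_mult_mat[of B m m C m \<gamma> m] by simp
  finally have C: "C = B * (C * \<gamma>) + C * (D * \<delta>)" .
  have "1\<^sub>m m = B * \<alpha> + C * \<beta>" using 1 by simp
  also have "C * \<beta> = (B * (C * \<gamma>) + C * (D * \<delta>)) * \<beta>" using C by simp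
  also have "B * \<alpha> + (B * (C * \<gamma>) + C * (D * \<delta>)) * \<beta> = B * (\<alpha> + C * \<gamma> * \<beta>) + (C * D) * (\<delta> * \<beta>)"
    by (simp add: assoc_add_mat[of _ m m])
  finally show ?thesis unfolding right_coprime_def
    by (intro bexI[of _ "\<alpha> + C * \<gamma> * \<beta>"] bexI[of _ "\<delta> * \<beta>"]) simp_all
qed

lemma right_coprime_mprod_list:
  assumes "B \<in> carrier_mat m m"
    and "\<And>C. C \<in> set Cs \<Longrightarrow> C \<in> carrier_mat m m \<and> B * C = C * B \<and> right_coprime m B C"
  shows "right_coprime m B (mprod_list m Cs)"
  using assms(2)
proof (induction Cs)
  case (Cons C Cs)
  then show ?case
    using assms(1) by (auto intro!: right_coprime_mult mprod_list_carrier)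
qed (simp add: right_coprime_one assms)

section \<open>Matrices of square blocks\<close>

text \<open>Block rows and columns are numbered from 1, as in \<^const>\<open>block_row\<close> and \<^const>\<open>A_poly\<close>.\<close>
definition block_mat :: "nat \<Rightarrow> nat \<Rightarrow> (nat \<Rightarrow> nat \<Rightarrow> mat_poly) \<Rightarrow> mat_poly" where
  "block_mat m q X = mat (q * m) (q * m)
     (\<lambda>(i, j). X (i div m + 1) (j div m + 1) $$ (i mod m, j mod m))"

lemma block_mat_carrier [simp]: "block_mat m q X \<in> carrier_mat (q * m) (q * m)"
  by (simp add: block_mat_def)

lemma block_index:
  fixes i q m :: nat
  assumes "i < q * m"
  shows "i div m < q" "i mod m < m" "i div m + 1 \<in> {1..q}"
proof -
  have m: "m > 0" using assms by (cases m) auto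
  show "i div m < q" using assms by (simp add: less_mult_imp_div_less)
  then show "i div m + 1 \<in> {1..q}" by auto
  show "i mod m < m" using m by simp
qed

lemma sum_blocks:
  fixes f :: "nat \<Rightarrow> nat \<Rightarrow> 'a :: comm_monoid_add"
  shows "(\<Sum>k<q * m. f (k div m) (k mod m)) = (\<Sum>b<q. \<Sum>l<m. f b l)"
proof (induction q)
  case (Suc q)
  have "(\<Sum>k<Suc q * m. f (k div m) (k mod m)) =
      (\<Sum>k<q * m. f (k div m) (k mod m)) + (\<Sum>k = q * m..<q * m + m. f (k div m) (k mod m))"
    using sum.atLeastLessThan_concat[of 0 "q * m" "q * m + m" "\<lambda>k. f (k div m) (k mod m)"]
    by (simp add: add.commute atLeast0LessThan)
  also have "(\<Sum>k = q * m..<q * m + m. f (k div m) (k mod m)) = (\<Sum>l<m. f q l)"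
    using sum.shift_bounds_nat_ivl[of "\<lambda>k. f (k div m) (k mod m)" 0 "q * m" m]
    by (simp add: add.commute atLeast0LessThan)
  finally show ?case using Suc by simp
qed simp

lemma diag_block_mat_eq_block_mat:
  assumes "\<forall>i\<in>{1..q}. B i \<in> carrier_mat m m"
  shows "diag_block_mat (map B [1..<Suc q]) = block_mat m q (\<lambda>i j. if i = j then B i else 0\<^sub>m m m)"
  using assms
proof (induction q)
  case 0
  show ?case by (auto simp: block_mat_def)
next
  case (Suc q)
  let ?D = "\<lambda>q. block_mat m q (\<lambda>i j. if i = j then B i else 0\<^sub>m m m)"
  have B: "B (Suc q) \<in> carrier_mat m m" using Suc.prems by auto
  have "diag_block_mat (map B [1..<Suc (Suc q)]) =
      four_block_mat (?D q) (0\<^sub>m (q * m) m) (0\<^sub>m m (q * m)) (B (Suc q))" (is "_ = ?R")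
  proof -
    have last: "map B [1..<Suc (Suc q)] = map B [1..<Suc q] @ [B (Suc q)]" by simp
    have IH: "diag_block_mat (map B [1..<Suc q]) = ?D q" using Suc.prems by (intro Suc.IH) simp
    show ?thesis
      unfolding last diag_block_mat_last Let_def IH carrier_matD[OF block_mat_carrier] carrier_matD[OF B] ..
  qed
  also have "\<dots> = ?D (Suc q)"
  proof (rule eq_matI)
    fix i j assume "i < dim_row (?D (Suc q))" "j < dim_col (?D (Suc q))"
    then have ij: "i < Suc q * m" "j < Suc q * m" by (simp_all add: block_mat_def)
    have high: "k div m = q" "k mod m = k - q * m" "k - q * m < m"
      if "k < Suc q * m" "\<not> k < q * m" for k
    proof -
      show "k - q * m < m" using that by simp
      show div: "k div m = q" using that by (intro div_nat_eqI) (simp_all add: mult.commute)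
      show "k mod m = k - q * m" using minus_div_mult_eq_mod[of k m] by (simp add: div)
    qed
    have low: "k div m < q" if "k < q * m" for k using block_index(1)[OF that] .
    note ib = block_index[OF ij(1)] and jb = block_index[OF ij(2)]
    have entry: "?R $$ (i, j) = (if i < q * m then if j < q * m then ?D q $$ (i, j) else 0
        else if j < q * m then 0 else B (Suc q) $$ (i - q * m, j - q * m))"
      using ij B by (simp add: carrier_matD[OF block_mat_carrier] add.commute)
    show "?R $$ (i, j) = ?D (Suc q) $$ (i, j)"
    proof (cases "i < q * m"; cases "j < q * m")
      assume "i < q * m" "j < q * m"
      then show ?thesis unfolding entry using ij by (simp add: block_mat_def)
    next
      assume "i < q * m" "\<not> j < q * m"
      then show ?thesis unfolding entry using ij low[of i] high[of j] ib(2) jb(2) by (simp add: block_mat_def)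
    next
      assume "\<not> i < q * m" "j < q * m"
      then show ?thesis unfolding entry using ij low[of j] high[of i] ib(2) jb(2) by (simp add: block_mat_def)
    next
      assume "\<not> i < q * m" "\<not> j < q * m"
      then show ?thesis unfolding entry using ij high[of i] high[of j] by (simp add: block_mat_def)
    qed
  qed (use B in \<open>auto simp: block_mat_def\<close>)
  finally show ?case .
qed

lemma diag_block_mat_mult_block_mat:
  assumes B: "\<forall>i\<in>{1..q}. B i \<in> carrier_mat m m"
    and X: "\<forall>i\<in>{1..q}. \<forall>j\<in>{1..q}. X i j \<in> carrier_mat m m"
  shows "diag_block_mat (map B [1..<Suc q]) * block_mat m q X = block_mat m q (\<lambda>i j. B i * X i j)"
proof (rule eq_matI)
  fix i j assume "i < dim_row (block_mat m q (\<lambda>i j. B i * X i j))"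
    "j < dim_col (block_mat m q (\<lambda>i j. B i * X i j))"
  then have ij: "i < q * m" "j < q * m" by (simp_all add: block_mat_def)
  let ?i = "i div m" and ?a = "i mod m" and ?j = "j div m" and ?b = "j mod m"
  note ib = block_index[OF ij(1)] and jb = block_index[OF ij(2)]
  have BX: "B (?i + 1) \<in> carrier_mat m m" "X (?i + 1) (?j + 1) \<in> carrier_mat m m"
    using B X ib(3) jb(3) by auto
  have "(diag_block_mat (map B [1..<Suc q]) * block_mat m q X) $$ (i, j)
      = (\<Sum>k<q * m. (if ?i + 1 = k div m + 1 then B (?i + 1) else 0\<^sub>m m m) $$ (?a, k mod m)
           * X (k div m + 1) (?j + 1) $$ (k mod m, ?b))"
    unfolding diag_block_mat_eq_block_mat[OF B] using ij
    by (simp add: block_mat_def scalar_prod_def atLeast0LessThan)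
  also have "\<dots> = (\<Sum>k<q. \<Sum>l<m. (if ?i + 1 = k + 1 then B (?i + 1) else 0\<^sub>m m m) $$ (?a, l)
           * X (k + 1) (?j + 1) $$ (l, ?b))"
    by (rule sum_blocks)
  also have "\<dots> = (\<Sum>k<q. if k = ?i then
      \<Sum>l<m. B (?i + 1) $$ (?a, l) * X (?i + 1) (?j + 1) $$ (l, ?b) else 0)"
    using ib(2) by (intro sum.cong) auto
  also have "\<dots> = (\<Sum>l<m. B (?i + 1) $$ (?a, l) * X (?i + 1) (?j + 1) $$ (l, ?b))"
    using ib(1) by simp
  also have "\<dots> = (B (?i + 1) * X (?i + 1) (?j + 1)) $$ (?a, ?b)"
    using BX ib(2) jb(2) by (simp add: scalar_prod_def atLeast0LessThan)
  also have "\<dots> = block_mat m q (\<lambda>i j. B i * X i j) $$ (i, j)"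
    using ij by (simp add: block_mat_def)
  finally show "(diag_block_mat (map B [1..<Suc q]) * block_mat m q X) $$ (i, j)
      = block_mat m q (\<lambda>i j. B i * X i j) $$ (i, j)" .
qed (simp_all only: diag_block_mat_eq_block_mat[OF B] index_mult_mat carrier_matD[OF block_mat_carrier])

lemma block_row_carrier [simp]: "block_row m q W \<in> carrier_mat m (q * m)"
  by (simp add: block_row_def)

lemma block_row_mult_block_mat:
  assumes W: "\<forall>i\<in>{1..q}. W i \<in> carrier_mat m m"
    and X: "\<forall>i\<in>{1..q}. \<forall>j\<in>{1..q}. X i j \<in> carrier_mat m m"
  shows "block_row m q W * block_mat m q X
    = block_row m q (\<lambda>j. msum_list m (map (\<lambda>i. W i * X i j) [1..<Suc q]))"
    (is "_ = block_row m q ?R")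
proof (rule eq_matI)
  fix a j assume "a < dim_row (block_row m q ?R)" "j < dim_col (block_row m q ?R)"
  then have aj: "a < m" "j < q * m" by (simp_all add: block_row_def)
  let ?j = "j div m" and ?b = "j mod m"
  note jb = block_index[OF aj(2)]
  have "(block_row m q W * block_mat m q X) $$ (a, j)
      = (\<Sum>k<q * m. W (k div m + 1) $$ (a, k mod m) * X (k div m + 1) (?j + 1) $$ (k mod m, ?b))"
    using aj by (simp add: block_row_def block_mat_def scalar_prod_def atLeast0LessThan)
  also have "\<dots> = (\<Sum>k<q. \<Sum>l<m. W (k + 1) $$ (a, l) * X (k + 1) (?j + 1) $$ (l, ?b))"
    by (rule sum_blocks)
  also have "\<dots> = (\<Sum>k<q. (W (k + 1) * X (k + 1) (?j + 1)) $$ (a, ?b))"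
  proof (rule sum.cong)
    fix k assume "k \<in> {..<q}"
    then have "W (k + 1) \<in> carrier_mat m m" "X (k + 1) (?j + 1) \<in> carrier_mat m m"
      using W X jb(3) by auto
    then show "(\<Sum>l<m. W (k + 1) $$ (a, l) * X (k + 1) (?j + 1) $$ (l, ?b))
        = (W (k + 1) * X (k + 1) (?j + 1)) $$ (a, ?b)"
      using aj(1) jb(2) by (simp add: scalar_prod_def atLeast0LessThan)
  qed simp
  also have "\<dots> = (\<Sum>k\<leftarrow>[1..<Suc q]. (W k * X k (?j + 1)) $$ (a, ?b))"
  proof -
    have "(\<Sum>k<q. (W (k + 1) * X (k + 1) (?j + 1)) $$ (a, ?b))
        = (\<Sum>k = 1..<Suc q. (W k * X k (?j + 1)) $$ (a, ?b))"
      using sum.shift_bounds_Suc_ivl[of "\<lambda>k. (W k * X k (?j + 1)) $$ (a, ?b)" 0 q]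
      by (simp add: atLeast0LessThan)
    then show ?thesis by (simp only: interv_sum_list_conv_sum_set_nat set_upt)
  qed
  also have "\<dots> = ?R (?j + 1) $$ (a, ?b)"
    using W X aj(1) jb(2,3)
    by (subst index_msum_list) (auto intro!: mult_carrier_mat simp: o_def simp del: upt_Suc)
  also have "\<dots> = block_row m q ?R $$ (a, j)" using aj by (simp add: block_row_def)
  finally show "(block_row m q W * block_mat m q X) $$ (a, j) = block_row m q ?R $$ (a, j)" .
qed (auto simp: block_row_def block_mat_def)

lemma kronecker_ones_mult:
  assumes R: "R \<in> carrier_mat m c"
  shows "kronecker (ones_col q) (1\<^sub>m m) * R = mat (q * m) c (\<lambda>(i, j). R $$ (i mod m, j))"
proof (rule eq_matI)
  fix i j assume "i < dim_row (mat (q * m) c (\<lambda>(i, j). R $$ (i mod m, j)))"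
    "j < dim_col (mat (q * m) c (\<lambda>(i, j). R $$ (i mod m, j)))"
  then have ij: "i < q * m" "j < c" by simp_all
  note ib = block_index[OF ij(1)]
  have "(kronecker (ones_col q) (1\<^sub>m m) * R) $$ (i, j)
      = (\<Sum>l<m. (if i mod m = l then 1 else 0) * R $$ (l, j))"
    using ij R ib by (simp add: kronecker_def ones_col_def scalar_prod_def atLeast0LessThan)
  also have "\<dots> = R $$ (i mod m, j)" using ib(2) by (simp add: if_distrib[of "\<lambda>x. x * _"] cong: if_cong)
  finally show "(kronecker (ones_col q) (1\<^sub>m m) * R) $$ (i, j)
      = mat (q * m) c (\<lambda>(i, j). R $$ (i mod m, j)) $$ (i, j)" using ij by simp
qed (use R in \<open>auto simp: kronecker_def ones_col_def\<close>)

lemma kronecker_ones_carrier [simp]: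
  "kronecker (ones_col q) (1\<^sub>m m) \<in> carrier_mat (q * m) m"
  by (simp add: kronecker_def ones_col_def)

lemma A_poly_carrier: "A_poly m q B W \<in> carrier_mat (q * m) (q * m)"
  unfolding A_poly_def
  by (rule add_carrier_mat[OF mult_carrier_mat[OF kronecker_ones_carrier block_row_carrier]])

text \<open>The index list \<open>[1..<Suc q]\<close> of all blocks is kept in one piece by the simplifier, so that facts
  about the whole product, sum or block diagonal still match.\<close>
declare upt_Suc [simp del]

section \<open>Block elimination\<close>

text \<open>Here \<open>M = diag (I, \<dots>, I, 0) + e R\<close>, where \<open>e\<close> is a column of identity blocks. Its last block
  row is that of \<open>e R\<close>, that is \<open>R\<close> itself; subtracting it from all the others leaves identity
  blocks there, and these then clear the last row except for its last block.\<close>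
lemma stacked_row_elimination:
  fixes M R :: "'a :: idom mat"
  assumes q: "q = Suc p" and R: "R \<in> carrier_mat m (q * m)"
    and M: "M = mat (q * m) (q * m)
      (\<lambda>(i, j). (if i = j \<and> i < p * m then 1 else 0) + R $$ (i mod m, j))"
  shows "\<exists>E\<in>carrier_mat (q * m) (q * m). det E = 1 \<and>
    E * M = four_block_mat (1\<^sub>m (p * m)) (0\<^sub>m (p * m) m) (0\<^sub>m m (p * m))
      (mat m m (\<lambda>(a, b). R $$ (a, p * m + b)))"
proof -
  let ?N = "p * m"
  define e where "e = mat ?N m (\<lambda>(i, j). if i mod m = j then 1 else 0 :: 'a)"
  define R\<^sub>1 where "R\<^sub>1 = mat m ?N (\<lambda>(a, j). R $$ (a, j))"
  define S where "S = mat m m (\<lambda>(a, b). R $$ (a, ?N + b))"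
  have c: "e \<in> carrier_mat ?N m" "R\<^sub>1 \<in> carrier_mat m ?N" "S \<in> carrier_mat m m"
    by (simp_all add: e_def R\<^sub>1_def S_def)
  have eX: "(e * X) $$ (i, j) = X $$ (i mod m, j)"
    if X: "X \<in> carrier_mat m c" and i: "i < ?N" and j: "j < c" for X i j c
  proof -
    note ib = block_index[OF i]
    have "(e * X) $$ (i, j) = (\<Sum>l<m. (if i mod m = l then 1 else 0) * X $$ (l, j))"
      using X i j by (simp add: e_def scalar_prod_def atLeast0LessThan)
    then show ?thesis using ib(2) by (simp add: if_distrib[of "\<lambda>x. x * _"] cong: if_cong)
  qed
  have M_blocks: "M = four_block_mat (1\<^sub>m ?N + e * R\<^sub>1) (e * S) R\<^sub>1 S" (is "M = ?M")
  proof (rule eq_matI)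
    fix i j assume "i < dim_row ?M" "j < dim_col ?M"
    then have ij: "i < ?N + m" "j < ?N + m" using c by auto
    have low: "i mod m < m" if "i < ?N" using block_index(2)[OF that] .
    have high: "i mod m = i - ?N" if "\<not> i < ?N"
    proof -
      have "i = i - ?N + p * m" using that by simp
      then have "i mod m = (i - ?N) mod m" by (metis mod_mult_self1)
      then show ?thesis using that ij by simp
    qed
    have R\<^sub>1_entry: "R\<^sub>1 $$ (a, b) = R $$ (a, b)" if "a < m" "b < ?N" for a b
      using that by (simp add: R\<^sub>1_def)
    have S_entry: "S $$ (a, b) = R $$ (a, ?N + b)" if "a < m" "b < m" for a b
      using that by (simp add: S_def)
    show "M $$ (i, j) = ?M $$ (i, j)"
    proof (cases "i < ?N")
      case True
      then show ?thesis using ij c low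
        by (cases "j < ?N")
          (simp_all add: M q eX[OF c(2)] eX[OF c(3)] R\<^sub>1_entry S_entry
            del: index_mult_mat(1))
    next
      case False
      then show ?thesis using ij c high by (cases "j < ?N") (simp_all add: M q R\<^sub>1_entry S_entry)
    qed
  qed (use c in \<open>simp_all add: M q\<close>)
  let ?U = "four_block_mat (1\<^sub>m ?N) (- e) (0\<^sub>m m ?N) (1\<^sub>m m)"
  let ?V = "four_block_mat (1\<^sub>m ?N) (0\<^sub>m ?N m) (- R\<^sub>1) (1\<^sub>m m)"
  have dets: "det ?U = 1" "det ?V = 1"
    using det_four_block_mat_lower_left_zero[OF one_carrier_mat uminus_carrier_mat[OF c(1)] refl one_carrier_mat]
      det_four_block_mat_upper_right_zero[OF one_carrier_mat refl uminus_carrier_mat[OF c(2)] one_carrier_mat]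
    by simp_all
  have UV: "?U \<in> carrier_mat (q * m) (q * m)" "?V \<in> carrier_mat (q * m) (q * m)"
    using four_block_carrier_mat[of "1\<^sub>m ?N" ?N ?N "1\<^sub>m m" m m] by (simp_all add: q add.commute)
  have "?U * M = four_block_mat (1\<^sub>m ?N) (0\<^sub>m ?N m) R\<^sub>1 S"
  proof -
    have 1: "1\<^sub>m ?N * (1\<^sub>m ?N + e * R\<^sub>1) + - e * R\<^sub>1 = 1\<^sub>m ?N"
      using c by (intro eq_matI) auto
    have 2: "1\<^sub>m ?N * (e * S) + - e * S = 0\<^sub>m ?N m"
      using c by (intro eq_matI) auto
    have 3: "0\<^sub>m m ?N * (1\<^sub>m ?N + e * R\<^sub>1) + 1\<^sub>m m * R\<^sub>1 = R\<^sub>1"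
      using c by auto
    have 4: "0\<^sub>m m ?N * (e * S) + 1\<^sub>m m * S = S" using c by auto
    show ?thesis unfolding M_blocks
      by (subst mult_four_block_mat[of _ ?N ?N _ m _ m _ _ ?N _ m], use c in \<open>simp_all only: 1 2 3 4\<close>) auto
  qed
  moreover have "?V * four_block_mat (1\<^sub>m ?N) (0\<^sub>m ?N m) R\<^sub>1 S
      = four_block_mat (1\<^sub>m ?N) (0\<^sub>m ?N m) (0\<^sub>m m ?N) S"
  proof -
    have 3: "- R\<^sub>1 * 1\<^sub>m ?N + 1\<^sub>m m * R\<^sub>1 = 0\<^sub>m m ?N"
      using c by (intro eq_matI) auto
    have 4: "- R\<^sub>1 * 0\<^sub>m ?N m + 1\<^sub>m m * S = S" using c by auto
    show ?thesis
      by (subst mult_four_block_mat[of _ ?N ?N _ m _ m _ _ ?N _ m], use c in \<open>simp_all only: 3 4\<close>) auto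
  qed
  moreover have "M \<in> carrier_mat (q * m) (q * m)" by (simp add: M)
  ultimately have "?V * ?U * M = four_block_mat (1\<^sub>m ?N) (0\<^sub>m ?N m) (0\<^sub>m m ?N) S"
    using UV assoc_mult_mat[of ?V "q * m" "q * m" ?U "q * m" M "q * m"] by simp
  moreover have "det (?V * ?U) = 1" using det_mult[OF UV(2,1)] dets by simp
  ultimately show ?thesis unfolding S_def using mult_carrier_mat[OF UV(2,1)] by blast
qed

lemma det_diag_block_mat:
  fixes B :: "nat \<Rightarrow> mat_poly"
  assumes "\<forall>i\<in>{1..q}. B i \<in> carrier_mat m m"
  shows "det (diag_block_mat (map B [1..<Suc q])) = (\<Prod>i\<leftarrow>[1..<Suc q]. det (B i))"
  using assms
proof (induction q)
  case (Suc q)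
  have B: "\<forall>i\<in>{1..q}. B i \<in> carrier_mat m m" "B (Suc q) \<in> carrier_mat m m" using Suc.prems by auto
  have D: "diag_block_mat (map B [1..<Suc q]) \<in> carrier_mat (q * m) (q * m)"
    using diag_block_mat_eq_block_mat[OF B(1)] by simp
  have "[1..<Suc (Suc q)] = [1..<Suc q] @ [Suc q]" by (rule upt_Suc_append) simp
  then show ?case using Suc.IH[OF B(1)]
    by (simp only: map_append list.map diag_block_mat_last Let_def carrier_matD[OF D] carrier_matD[OF B(2)]
        det_four_block_mat_lower_left_zero[OF D zero_carrier_mat refl B(2)]) simp
qed simp

section \<open>Chinese remainders for commuting matrix polynomials\<close>

text \<open>A Chinese remainder statement. Since \<open>B k\<close> is coprime to the product \<open>C\<close> of the other factors,
  \<open>B k * a + C * b = 1\<close>, and \<open>T = - C * b\<close> is congruent to \<open>-1\<close> modulo \<open>B k\<close> and to 0 modulo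
  every other \<open>B i\<close>. The matrices \<open>X i\<close> form a column that \<open>diag (B 1, \<dots>, B q)\<close> sends to the
  \<open>k\<close>-th block unit vector plus the constant column \<open>e T\<close>.\<close>
lemma cofactor_column:
  fixes q :: nat
  assumes k: "k \<in> {1..q}"
    and B: "\<forall>i\<in>{1..q}. B i \<in> carrier_mat m m"
    and comm: "\<forall>i\<in>{1..q}. \<forall>j\<in>{1..q}. B i * B j = B j * B i"
    and coprime: "\<forall>i\<in>{1..q}. \<forall>j\<in>{1..q}. i \<noteq> j \<longrightarrow> right_coprime m (B i) (B j)"
  shows "\<exists>X T. T \<in> carrier_mat m m \<and> (\<forall>i\<in>{1..q}. X i \<in> carrier_mat m m \<and>
    B i * X i = (if i = k then 1\<^sub>m m else 0\<^sub>m m m) + T)"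
proof -
  let ?C = "cofactor_prod m q B k"
  have Bk: "B k \<in> carrier_mat m m" using B k by auto
  have C: "?C \<in> carrier_mat m m"
    unfolding cofactor_prod_def using B by (intro mprod_list_carrier) auto
  have "right_coprime m (B k) ?C"
    unfolding cofactor_prod_def using B comm coprime k by (intro right_coprime_mprod_list) auto
  then obtain a b where ab: "a \<in> carrier_mat m m" "b \<in> carrier_mat m m" "B k * a + ?C * b = 1\<^sub>m m"
    unfolding right_coprime_def by auto
  define T where "T = - (?C * b)"
  have T: "T \<in> carrier_mat m m" unfolding T_def using C ab by auto
  have "\<exists>Y\<in>carrier_mat m m. B i * Y = (if i = k then 1\<^sub>m m else 0\<^sub>m m m) + T" if i: "i \<in> {1..q}" for i
  proof (cases "i = k")
    case True
    have "U + V + - V = U" if "U \<in> carrier_mat m m" "V \<in> carrier_mat m m" for U V :: mat_poly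
      using that by (intro eq_matI) auto
    from this[of "B k * a" "?C * b"] have "B k * a = 1\<^sub>m m + T"
      unfolding ab(3) T_def using Bk C ab(1,2) by auto
    then show ?thesis using ab True by auto
  next
    case False
    have Bi: "B i \<in> carrier_mat m m" using B i by auto
    define H where "H = mprod_list m (map B (filter (\<lambda>j. j \<noteq> i) (filter (\<lambda>j. j \<noteq> k) [1..<Suc q])))"
    have H: "H \<in> carrier_mat m m" unfolding H_def using B by (intro mprod_list_carrier) auto
    have "?C = B i * H"
      unfolding cofactor_prod_def H_def using B comm i False by (intro mprod_list_extract) auto
    then have "?C * b = B i * (H * b)" using assoc_mult_mat[OF Bi H ab(2)] by simp
    then have "B i * (- (H * b)) = T" unfolding T_def using Bi H ab by auto
    then show ?thesis using False T H ab by (intro bexI[of _ "- (H * b)"]) auto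
  qed
  then show ?thesis using T by metis
qed

section \<open>Equivalence to the product plus the weighted cofactors\<close>

text \<open>If \<open>D X = diag (I, \<dots>, I, 0) + e T\<close> with \<open>D = diag (B 1, \<dots>, B q)\<close>, then
  \<open>(D + e W) X = diag (I, \<dots>, I, 0) + e (T + W X)\<close> has the same shape for every block row \<open>W\<close>,
  so that row operations reduce it to \<open>diag (I, \<dots>, I, S)\<close>, with \<open>S\<close> the last block of
  \<open>T + W X\<close>.\<close>
lemma A_poly_mult_block_mat:
  assumes B: "\<forall>i\<in>{1..q}. B i \<in> carrier_mat m m"
    and W: "\<forall>i\<in>{1..q}. W i \<in> carrier_mat m m"
    and X: "\<forall>i\<in>{1..q}. \<forall>j\<in>{1..q}. X i j \<in> carrier_mat m m"
    and T: "\<forall>j\<in>{1..q}. T j \<in> carrier_mat m m"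
    and q: "q = Suc p"
    and BX: "\<forall>i\<in>{1..q}. \<forall>j\<in>{1..q}. B i * X i j = (if i = j \<and> i < q then 1\<^sub>m m else 0\<^sub>m m m) + T j"
  shows "\<exists>E\<in>carrier_mat (q * m) (q * m). det E = 1 \<and>
    E * (A_poly m q B W * block_mat m q X) =
    four_block_mat (1\<^sub>m (p * m)) (0\<^sub>m (p * m) m) (0\<^sub>m m (p * m))
      (T q + msum_list m (map (\<lambda>i. W i * X i q) [1..<Suc q]))"
proof -
  let ?G = "\<lambda>j. msum_list m (map (\<lambda>i. W i * X i j) [1..<Suc q])"
  define R where "R = block_row m q (\<lambda>j. T j + ?G j)"
  have G: "?G j \<in> carrier_mat m m" if "j \<in> {1..q}" for j
    using that W X by (intro msum_list_carrier) (auto intro!: mult_carrier_mat)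
  let ?K = "kronecker (ones_col q) (1\<^sub>m m :: mat_poly)"
  let ?F = "block_mat m q X"
  have D: "diag_block_mat (map B [1..<Suc q]) \<in> carrier_mat (q * m) (q * m)"
    using diag_block_mat_eq_block_mat[OF B] by simp
  have "A_poly m q B W * ?F = diag_block_mat (map B [1..<Suc q]) * ?F + ?K * block_row m q W * ?F"
    unfolding A_poly_def
    by (rule add_mult_distrib_mat[OF D
          mult_carrier_mat[OF kronecker_ones_carrier block_row_carrier] block_mat_carrier])
  also have "?K * block_row m q W * ?F = ?K * (block_row m q W * ?F)"
    by (rule assoc_mult_mat[OF kronecker_ones_carrier block_row_carrier block_mat_carrier])
  also have "\<dots> = mat (q * m) (q * m) (\<lambda>(i, j). block_row m q ?G $$ (i mod m, j))"
    unfolding block_row_mult_block_mat[OF W X] by (rule kronecker_ones_mult) simp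
  also have "diag_block_mat (map B [1..<Suc q]) * ?F + \<dots> = mat (q * m) (q * m)
      (\<lambda>(i, j). (if i = j \<and> i < p * m then 1 else 0) + R $$ (i mod m, j))" (is "_ = ?M")
    unfolding diag_block_mat_mult_block_mat[OF B X]
  proof (rule eq_matI)
    fix i j assume "i < dim_row ?M" "j < dim_col ?M"
    then have ij: "i < q * m" "j < q * m" by simp_all
    note ib = block_index[OF ij(1)] and jb = block_index[OF ij(2)]
    let ?i = "i div m" and ?a = "i mod m" and ?j = "j div m" and ?b = "j mod m"
    have carriers: "T (?j + 1) \<in> carrier_mat m m" "?G (?j + 1) \<in> carrier_mat m m"
      using T G jb(3) by auto
    have eq: "i = j \<longleftrightarrow> ?i = ?j \<and> ?a = ?b" by (metis div_mult_mod_eq)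
    have less: "?i + 1 < q \<longleftrightarrow> i < p * m"
      using ib(2) by (simp add: q div_less_iff_less_mult)
    have BX': "B (?i + 1) * X (?i + 1) (?j + 1) = (if ?i = ?j \<and> i < p * m then 1\<^sub>m m else 0\<^sub>m m m) + T (?j + 1)"
    proof -
      have "B (?i + 1) * X (?i + 1) (?j + 1)
          = (if ?i + 1 = ?j + 1 \<and> ?i + 1 < q then 1\<^sub>m m else 0\<^sub>m m m) + T (?j + 1)"
        using BX ib(3) jb(3) by blast
      then show ?thesis unfolding less by simp
    qed
    have "(B (?i + 1) * X (?i + 1) (?j + 1)) $$ (?a, ?b) + block_row m q ?G $$ (?a, j)
        = (if i = j \<and> i < p * m then 1 else 0) + R $$ (?a, j)"
      unfolding BX' R_def using carriers ib(2) jb(2) ij eq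
      by (simp add: block_row_def add.assoc)
    then show "(block_mat m q (\<lambda>i j. B i * X i j)
        + mat (q * m) (q * m) (\<lambda>(i, j). block_row m q ?G $$ (i mod m, j))) $$ (i, j) = ?M $$ (i, j)"
      using ij by (simp add: block_mat_def)
  qed (simp_all add: block_mat_def)
  finally have AF: "A_poly m q B W * ?F = ?M" .
  have "mat m m (\<lambda>(a, b). R $$ (a, p * m + b)) = T q + ?G q" (is "?S = _")
  proof (rule eq_matI)
    fix a b assume "a < dim_row (T q + ?G q)" "b < dim_col (T q + ?G q)"
    then have ab: "a < m" "b < m" using G[of q] T q by auto
    then have "(p * m + b) div m = p" "(p * m + b) mod m = b" "p * m + b < q * m"
      by (auto simp: q)
    then show "?S $$ (a, b) = (T q + ?G q) $$ (a, b)"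
      using ab by (simp add: R_def block_row_def q)
  qed (use G[of q] T q in auto)
  then show ?thesis
    using stacked_row_elimination[OF q _ AF] unfolding R_def by simp
qed

text \<open>The columns of \<open>X\<close> are those of the Chinese remainder lemma for \<open>k < q\<close>, and last the cofactors
  \<open>C i\<close>: as \<open>B i * C i\<close> is the full product for every \<open>i\<close>, that column is sent to \<open>e \<Pi>\<close>, and the
  remaining block is \<open>\<Pi> + \<Sum> W i * C i\<close>. Comparing determinants for \<open>W = 0\<close>,
  with \<open>D\<close> the block diagonal matrix of the \<open>B i\<close>, gives
  \<open>det D * det X = det \<Pi> = det D\<close>, and \<open>det D \<noteq> 0\<close> because the \<open>B i\<close> are regular; hence
  \<open>det X = 1\<close>.\<close>
lemma A_poly_equivalent:
  assumes q: "0 < q"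
    and B: "\<forall>i\<in>{1..q}. B i \<in> carrier_mat m m"
    and W: "\<forall>i\<in>{1..q}. W i \<in> carrier_mat m m"
    and reg: "\<forall>i\<in>{1..q}. mregular (B i)"
    and comm: "\<forall>i\<in>{1..q}. \<forall>j\<in>{1..q}. B i * B j = B j * B i"
    and coprime: "\<forall>i\<in>{1..q}. \<forall>j\<in>{1..q}. i \<noteq> j \<longrightarrow> right_coprime m (B i) (B j)"
  shows "mequivalent m q (A_poly m q B W) (mprod_list m (map B [1..<Suc q])
    + msum_list m (map (\<lambda>i. W i * cofactor_prod m q B i) [1..<Suc q]))"
    (is "mequivalent m q _ (?\<Pi> + ?\<Sigma>)")
proof -
  obtain p where p: "q = Suc p" using q by (cases q) auto
  obtain Y U where YU: "\<forall>k\<in>{1..q}. U k \<in> carrier_mat m m \<and> (\<forall>i\<in>{1..q}. Y k i \<in> carrier_mat m m \<and>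
      B i * Y k i = (if i = k then 1\<^sub>m m else 0\<^sub>m m m) + U k)"
    using cofactor_column[OF _ B comm coprime] by metis
  define X where "X = (\<lambda>i j. if j < q then Y j i else cofactor_prod m q B i)"
  define T where "T = (\<lambda>j. if j < q then U j else ?\<Pi>)"
  have C: "cofactor_prod m q B i \<in> carrier_mat m m" for i
    unfolding cofactor_prod_def using B by (intro mprod_list_carrier) auto
  have \<Pi>: "?\<Pi> \<in> carrier_mat m m" using B by (intro mprod_list_carrier) auto
  have \<Sigma>: "?\<Sigma> \<in> carrier_mat m m" using W C by (intro msum_list_carrier) (auto intro!: mult_carrier_mat)
  have BC: "B i * cofactor_prod m q B i = ?\<Pi>" if "i \<in> {1..q}" for i
    unfolding cofactor_prod_def using that B comm by (intro mprod_list_extract[symmetric]) auto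
  have X: "\<forall>i\<in>{1..q}. \<forall>j\<in>{1..q}. X i j \<in> carrier_mat m m" using YU C by (auto simp: X_def)
  have T: "\<forall>j\<in>{1..q}. T j \<in> carrier_mat m m" using YU \<Pi> by (auto simp: T_def)
  have BX: "\<forall>i\<in>{1..q}. \<forall>j\<in>{1..q}. B i * X i j = (if i = j \<and> i < q then 1\<^sub>m m else 0\<^sub>m m m) + T j"
    using YU BC \<Pi> by (auto simp: X_def T_def)
  have Xq: "X i q = cofactor_prod m q B i" "T q = ?\<Pi>" for i by (simp_all add: X_def T_def)
  let ?F = "block_mat m q X" and ?A = "A_poly m q B W" and ?D = "diag_block_mat (map B [1..<Suc q])"
  let ?N = "p * m"
  have D: "?D \<in> carrier_mat (q * m) (q * m)" using diag_block_mat_eq_block_mat[OF B] by simp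
  have detD: "det ?D = det ?\<Pi>" "det ?D \<noteq> 0"
  proof -
    show "det ?D = det ?\<Pi>"
      using B by (subst det_diag_block_mat[OF B], subst det_mprod_list) (auto simp: o_def)
    show "det ?D \<noteq> 0"
      using reg unfolding det_diag_block_mat[OF B] prod_list_zero_iff by (auto simp: mregular_def)
  qed
  \<comment> \<open>The entries of \<open>X\<close> do not depend on \<open>W\<close>, so its determinant can be found with \<open>W = 0\<close>.\<close>
  have detF: "det ?F = 1"
  proof -
    have zero: "\<forall>i\<in>{1..q}. (\<lambda>_. 0\<^sub>m m m :: mat_poly) i \<in> carrier_mat m m" by simp
    obtain E where E: "E \<in> carrier_mat (q * m) (q * m)" "det E = 1"
      "E * (A_poly m q B (\<lambda>_. 0\<^sub>m m m) * ?F) = four_block_mat (1\<^sub>m ?N) (0\<^sub>m ?N m) (0\<^sub>m m ?N)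
        (?\<Pi> + msum_list m (map (\<lambda>i. 0\<^sub>m m m * X i q) [1..<Suc q]))"
      using A_poly_mult_block_mat[OF B zero X T p BX] unfolding Xq by auto
    have AD: "A_poly m q B (\<lambda>_. 0\<^sub>m m m) = ?D"
    proof -
      have "block_row m q (\<lambda>_. 0\<^sub>m m m) = 0\<^sub>m m (q * m)"
        by (rule eq_matI) (auto simp: block_row_def dest: block_index)
      then show ?thesis unfolding A_poly_def
        using right_mult_zero_mat[OF kronecker_ones_carrier] D by simp
    qed
    have zeros: "msum_list m (map (\<lambda>i. 0\<^sub>m m m * X i q) xs) = 0\<^sub>m m m" if "set xs \<subseteq> {1..q}" for xs
      using that
    proof (induction xs)
      case (Cons x xs)
      then have "X x q \<in> carrier_mat m m" using X q by auto
      then show ?case using Cons by simp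
    qed simp
    have "msum_list m (map (\<lambda>i. 0\<^sub>m m m * X i q) [1..<Suc q]) = 0\<^sub>m m m"
      by (rule zeros) auto
    then have "E * (?D * ?F) = four_block_mat (1\<^sub>m ?N) (0\<^sub>m ?N m) (0\<^sub>m m ?N) ?\<Pi>"
      using E(3) \<Pi> AD by simp
    then have "det (E * (?D * ?F)) = det ?\<Pi>"
      using det_four_block_mat_lower_left_zero[OF one_carrier_mat zero_carrier_mat refl \<Pi>] by simp
    then have "det ?D * det ?F = det ?D"
      using E(2) detD(1) det_mult[OF E(1) mult_carrier_mat[OF D block_mat_carrier]]
        det_mult[OF D block_mat_carrier]
      by simp
    then show ?thesis using detD(2) by simp
  qed
  obtain E where E: "E \<in> carrier_mat (q * m) (q * m)" "det E = 1"
    "E * (?A * ?F) = four_block_mat (1\<^sub>m ?N) (0\<^sub>m ?N m) (0\<^sub>m m ?N) (?\<Pi> + ?\<Sigma>)"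
    using A_poly_mult_block_mat[OF B W X T p BX] unfolding Xq by auto
  have "E * ?A * ?F = diag_block_mat [1\<^sub>m (m * (q - 1)), ?\<Pi> + ?\<Sigma>]"
    using E(3) assoc_mult_mat[OF E(1) A_poly_carrier block_mat_carrier] \<Sigma>
      diag_block_mat.simps(2)[of "1\<^sub>m (m * (q - 1))" "[?\<Pi> + ?\<Sigma>]"]
    by (simp add: Let_def p mult.commute del: diag_block_mat.simps(2))
  moreover have "munimodular E" "munimodular ?F"
    unfolding munimodular_def using E(2) detF by (auto intro!: exI[of _ 1] simp: one_pCons)
  ultimately show ?thesis
    unfolding mequivalent_def using E(1) \<Pi> \<Sigma> by (blast intro: A_poly_carrier block_mat_carrier add_carrier_mat)
qed

section \<open>Reversal at a prescribed degree\<close>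

text \<open>Reversal with respect to a prescribed degree \<open>k\<close> instead of the actual one, that is
  \<open>x\<^sup>k p(1/x)\<close> when \<open>degree p \<le> k\<close>. This makes reversal additive, and multiplicative with the
  degrees adding up, even if leading coefficients cancel.\<close>
definition rev_poly :: "nat \<Rightarrow> complex poly \<Rightarrow> complex poly" where
  "rev_poly k p = (\<Sum>i\<le>k. monom (coeff p i) (k - i))"

definition rev_mat :: "nat \<Rightarrow> mat_poly \<Rightarrow> mat_poly" where
  "rev_mat k Q = map_mat (rev_poly k) Q"

definition entries_degree_le :: "nat \<Rightarrow> mat_poly \<Rightarrow> bool" where
  "entries_degree_le k Q \<longleftrightarrow> (\<forall>i<dim_row Q. \<forall>j<dim_col Q. degree (Q $$ (i, j)) \<le> k)"

lemma coeff_rev_poly: "coeff (rev_poly k p) j = (if j \<le> k then coeff p (k - j) else 0)"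
proof -
  have "coeff (rev_poly k p) j = (\<Sum>i\<le>k. if i = k - j \<and> j \<le> k then coeff p i else 0)"
    unfolding rev_poly_def coeff_sum coeff_monom by (intro sum.cong) auto
  then show ?thesis by simp
qed

lemma rev_poly_0 [simp]: "rev_poly k 0 = 0"
  by (simp add: rev_poly_def)

lemma rev_poly_add: "rev_poly k (p + r) = rev_poly k p + rev_poly k r"
  by (intro poly_eqI) (simp add: coeff_rev_poly)

lemma rev_poly_sum: "rev_poly k (\<Sum>x\<in>A. f x) = (\<Sum>x\<in>A. rev_poly k (f x))"
  by (induction A rule: infinite_finite_induct) (simp_all add: rev_poly_add)

text \<open>\<^const>\<open>reflect_poly\<close> reverses at the exact degree and is multiplicative; the two reversals
  differ by a power of \<open>x\<close>.\<close>
lemma rev_poly_reflect: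
  assumes "degree p \<le> k"
  shows "rev_poly k p = monom 1 (k - degree p) * reflect_poly p"
  using assms by (intro poly_eqI)
    (auto simp: coeff_rev_poly coeff_monom_mult coeff_reflect_poly coeff_eq_0 not_le)

lemma rev_poly_mult:
  assumes "degree p \<le> k" "degree r \<le> l"
  shows "rev_poly (k + l) (p * r) = rev_poly k p * rev_poly l r"
proof (cases "p = 0 \<or> r = 0")
  case False
  then have deg: "degree (p * r) = degree p + degree r" by (simp add: degree_mult_eq)
  have "monom 1 (k + l - (degree p + degree r)) = monom 1 (k - degree p) * monom (1 :: complex) (l - degree r)"
    using assms by (simp add: mult_monom)
  then show ?thesis
    using assms by (simp add: rev_poly_reflect deg reflect_poly_mult mult_ac)
qed auto

lemma poly_rev_poly:
  assumes "degree p \<le> k" "x \<noteq> 0"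
  shows "poly (rev_poly k p) x = x ^ k * poly p (inverse x)"
proof -
  have "x ^ (k - degree p) * x ^ degree p = x ^ k" using assms by (simp flip: power_add)
  then show ?thesis
    using assms by (simp add: rev_poly_reflect poly_reflect_poly_nz poly_monom flip: mult.assoc)
qed

lemma rev_mat_carrier [simp]: "rev_mat k Q \<in> carrier_mat n c \<longleftrightarrow> Q \<in> carrier_mat n c"
  by (simp add: rev_mat_def)

lemma mreversed_eq_rev_mat: "mdegree Q = int k \<Longrightarrow> mreversed Q = rev_mat k Q"
  by (simp add: mreversed_def rev_mat_def rev_poly_def[abs_def])

lemma entries_degree_leI:
  assumes "mdegree Q \<le> int k"
  shows "entries_degree_le k Q"
  unfolding entries_degree_le_def
proof (intro allI impI degree_le)
  fix r c i assume rc: "r < dim_row Q" "c < dim_col Q" and "i > k"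
  then have "mcoeff Q i = 0\<^sub>m (dim_row Q) (dim_col Q)"
    using assms by (intro mcoeff_eq_0_above) simp
  then have "mcoeff Q i $$ (r, c) = 0" using rc by simp
  then show "coeff (Q $$ (r, c)) i = 0" using rc by (simp add: mcoeff_def)
qed

lemma mdegree_eqI:
  assumes "entries_degree_le k Q" "i < dim_row Q" "j < dim_col Q" "coeff (Q $$ (i, j)) k \<noteq> 0"
  shows "mdegree Q = int k"
proof -
  let ?P = "\<lambda>i. mcoeff Q i \<noteq> 0\<^sub>m (dim_row Q) (dim_col Q)"
  have "Q \<noteq> 0\<^sub>m (dim_row Q) (dim_col Q)"
  proof
    assume "Q = 0\<^sub>m (dim_row Q) (dim_col Q)"
    then have "Q $$ (i, j) = 0" using assms(2,3) by (metis index_zero_mat(1))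
    then show False using assms(4) by simp
  qed
  moreover have "Greatest ?P = k"
  proof (rule Greatest_equality)
    have "mcoeff Q k $$ (i, j) \<noteq> 0" using assms by (simp add: mcoeff_def)
    then show "?P k" using assms(2,3) by auto
  next
    fix l assume "?P l"
    then obtain r c where "r < dim_row Q" "c < dim_col Q" "coeff (Q $$ (r, c)) l \<noteq> 0"
      by (auto simp: mcoeff_def mat_eq_iff)
    then show "l \<le> k" using assms(1) unfolding entries_degree_le_def by (meson le_degree le_trans)
  qed
  ultimately show ?thesis by (simp add: mdegree_def)
qed

lemma mdegree_witness:
  assumes "mdegree Q = int k"
  obtains i j where "i < dim_row Q" "j < dim_col Q" "coeff (Q $$ (i, j)) k \<noteq> 0"
proof -
  let ?P = "\<lambda>i. mcoeff Q i \<noteq> 0\<^sub>m (dim_row Q) (dim_col Q)"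
  have Q: "Q \<noteq> 0\<^sub>m (dim_row Q) (dim_col Q)" and k: "k = Greatest ?P"
    using assms by (auto simp: mdegree_def split: if_splits)
  obtain r c where rc: "r < dim_row Q" "c < dim_col Q" "Q $$ (r, c) \<noteq> 0"
    using Q by (auto simp: mat_eq_iff)
  then have "mcoeff Q (degree (Q $$ (r, c))) $$ (r, c) \<noteq> 0" by (simp add: mcoeff_def)
  then have "?P (degree (Q $$ (r, c)))" using rc by auto
  moreover have "l \<le> k" if "?P l" for l
  proof (rule ccontr)
    assume "\<not> l \<le> k"
    then show False using that mcoeff_eq_0_above[of Q l] assms by simp
  qed
  ultimately have "?P (Greatest ?P)" by (rule GreatestI_nat)
  then have "?P k" unfolding k[symmetric] .
  then obtain i j where "i < dim_row Q" "j < dim_col Q" "coeff (Q $$ (i, j)) k \<noteq> 0"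
    by (auto simp: mcoeff_def mat_eq_iff)
  then show ?thesis by (rule that)
qed

lemma entries_degree_le_mult:
  assumes "X \<in> carrier_mat n r" "Y \<in> carrier_mat r c" "entries_degree_le k X" "entries_degree_le l Y"
  shows "entries_degree_le (k + l) (X * Y)"
  unfolding entries_degree_le_def
proof (intro allI impI)
  fix i j assume "i < dim_row (X * Y)" "j < dim_col (X * Y)"
  then have ij: "i < n" "j < c" using assms by auto
  have "degree (X $$ (i, s) * Y $$ (s, j)) \<le> k + l" if "s < r" for s
    using assms ij that unfolding entries_degree_le_def
    by (intro order.trans[OF degree_mult_le] add_mono) auto
  then show "degree ((X * Y) $$ (i, j)) \<le> k + l"
    using ij assms by (auto simp: scalar_prod_def intro!: degree_sum_le)
qed

lemma rev_mat_mult: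
  assumes "X \<in> carrier_mat n r" "Y \<in> carrier_mat r c" "entries_degree_le k X" "entries_degree_le l Y"
  shows "rev_mat (k + l) (X * Y) = rev_mat k X * rev_mat l Y"
proof (rule eq_matI)
  fix i j assume "i < dim_row (rev_mat k X * rev_mat l Y)" "j < dim_col (rev_mat k X * rev_mat l Y)"
  then have ij: "i < n" "j < c" using assms by (auto simp: rev_mat_def)
  have "rev_poly (k + l) (\<Sum>s = 0..<r. X $$ (i, s) * Y $$ (s, j))
      = (\<Sum>s = 0..<r. rev_poly k (X $$ (i, s)) * rev_poly l (Y $$ (s, j)))"
    unfolding rev_poly_sum using assms ij
    by (intro sum.cong) (auto simp: entries_degree_le_def intro!: rev_poly_mult)
  then show "rev_mat (k + l) (X * Y) $$ (i, j) = (rev_mat k X * rev_mat l Y) $$ (i, j)"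
    using assms ij by (simp add: rev_mat_def scalar_prod_def)
qed (auto simp: rev_mat_def)

lemma rev_mat_add:
  assumes "X \<in> carrier_mat n c" "Y \<in> carrier_mat n c"
  shows "rev_mat k (X + Y) = rev_mat k X + rev_mat k Y"
  using assms by (intro eq_matI) (auto simp: rev_mat_def rev_poly_add)

lemma rev_mat_mprod_list:
  assumes "\<forall>Q\<in>set Qs. Q \<in> carrier_mat m m \<and> entries_degree_le d Q"
  shows "entries_degree_le (d * length Qs) (mprod_list m Qs)"
    and "rev_mat (d * length Qs) (mprod_list m Qs) = mprod_list m (map (rev_mat d) Qs)"
proof -
  have "entries_degree_le (d * length Qs) (mprod_list m Qs) \<and>
    rev_mat (d * length Qs) (mprod_list m Qs) = mprod_list m (map (rev_mat d) Qs)"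
    using assms
  proof (induction Qs)
    case Nil
    have "rev_poly 0 1 = 1" by (intro poly_eqI) (simp add: coeff_rev_poly)
    then show ?case by (auto simp: entries_degree_le_def rev_mat_def intro!: eq_matI)
  next
    case (Cons Q Qs)
    have "mprod_list m Qs \<in> carrier_mat m m" using Cons.prems by (intro mprod_list_carrier) auto
    then show ?case
      using Cons entries_degree_le_mult[of Q m m "mprod_list m Qs" m d "d * length Qs"]
        rev_mat_mult[of Q m m "mprod_list m Qs" m d "d * length Qs"] by simp
  qed
  then show "entries_degree_le (d * length Qs) (mprod_list m Qs)"
    "rev_mat (d * length Qs) (mprod_list m Qs) = mprod_list m (map (rev_mat d) Qs)" by auto
qed

lemma rev_mat_msum_list:
  assumes "\<forall>Q\<in>set Qs. Q \<in> carrier_mat m m"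
  shows "rev_mat k (msum_list m Qs) = msum_list m (map (rev_mat k) Qs)"
  using assms
proof (induction Qs)
  case (Cons Q Qs)
  then have "msum_list m Qs \<in> carrier_mat m m" by (intro msum_list_carrier) auto
  then show ?case using Cons by (simp add: rev_mat_add[of _ m m])
qed (auto simp: rev_mat_def intro!: eq_matI)

text \<open>For \<open>x \<noteq> 0\<close> the determinant of the reversal at \<open>x\<close> is a power of \<open>x\<close> times \<open>det Q\<close> at \<open>1/x\<close>.
  If it vanished identically, so would \<open>det Q\<close> at all nonzero points.\<close>
lemma mregular_rev_mat:
  assumes Q: "Q \<in> carrier_mat m m" and deg: "entries_degree_le k Q" and reg: "mregular Q"
  shows "mregular (rev_mat k Q)"
proof -
  have ev: "det (map_mat (\<lambda>p. poly p x) M) = poly (det M) x" for M :: mat_poly and x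
  proof -
    interpret comm_ring_hom "\<lambda>p :: complex poly. poly p x" by unfold_locales simp_all
    show ?thesis by (rule hom_det)
  qed
  have det: "poly (det (rev_mat k Q)) x = (x ^ k) ^ m * poly (det Q) (inverse x)" if "x \<noteq> 0" for x
  proof -
    have "map_mat (\<lambda>p. poly p x) (rev_mat k Q) = x ^ k \<cdot>\<^sub>m map_mat (\<lambda>p. poly p (inverse x)) Q"
      using deg Q that by (intro eq_matI) (auto simp: rev_mat_def entries_degree_le_def poly_rev_poly)
    then show ?thesis using Q by (simp flip: ev)
  qed
  \<comment> \<open>The factor \<open>x\<close> takes care of the point 0, at which reversal says nothing about \<open>det Q\<close>.\<close>
  have "poly (det Q * [:0, 1:]) x = 0" if "det (rev_mat k Q) = 0" for x
    using det[of "inverse x"] that by (cases "x = 0") simp_all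
  then have "det Q = 0" if "det (rev_mat k Q) = 0"
    using that poly_all_0_iff_0[of "det Q * [:0, 1:]"] by auto
  then show ?thesis using reg by (auto simp: mregular_def)
qed

lemma index_A_poly:
  assumes B: "\<forall>i\<in>{1..q}. B i \<in> carrier_mat m m" and ij: "i < q * m" "j < q * m"
  shows "A_poly m q B W $$ (i, j) =
    (if i div m = j div m then B (i div m + 1) $$ (i mod m, j mod m) else 0)
      + W (j div m + 1) $$ (i mod m, j mod m)"
proof -
  note ib = block_index[OF ij(1)] and jb = block_index[OF ij(2)]
  show ?thesis
    unfolding A_poly_def diag_block_mat_eq_block_mat[OF B] kronecker_ones_mult[OF block_row_carrier]
    using ij ib jb by (simp add: block_mat_def block_row_def)
qed

lemma entries_degree_leD:
  "entries_degree_le k Q \<Longrightarrow> Q \<in> carrier_mat n c \<Longrightarrow> i < n \<Longrightarrow> j < c \<Longrightarrow> degree (Q $$ (i, j)) \<le> k"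
  by (auto simp: entries_degree_le_def)

text \<open>As \<open>W 1\<close> has degree below \<open>d\<close>, it cannot cancel the leading coefficient of \<open>B 1\<close> in the first
  diagonal block.\<close>
lemma mdegree_A_poly:
  assumes q: "0 < q"
    and B: "\<forall>i\<in>{1..q}. B i \<in> carrier_mat m m" "\<forall>i\<in>{1..q}. mdegree (B i) = int d"
    and W: "\<forall>i\<in>{1..q}. W i \<in> carrier_mat m m" "\<forall>i\<in>{1..q}. mdegree (W i) < int d"
  shows "mdegree (A_poly m q B W) = int d"
proof -
  note A = carrier_matD[OF A_poly_carrier]
  have "mdegree (B 1) = int d" "B 1 \<in> carrier_mat m m" "W 1 \<in> carrier_mat m m" "mdegree (W 1) < int d"
    using q B W by auto
  then obtain i j where ij: "i < m" "j < m" "coeff (B 1 $$ (i, j)) d \<noteq> 0"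
    using mdegree_witness[of "B 1" d] by auto
  have "mcoeff (W 1) d $$ (i, j) = 0"
    using mcoeff_eq_0_above[of "W 1" d] \<open>W 1 \<in> _\<close> \<open>mdegree (W 1) < _\<close> ij by simp
  then have W1: "coeff (W 1 $$ (i, j)) d = 0" using \<open>W 1 \<in> _\<close> ij by (simp add: mcoeff_def)
  have ij': "i < q * m" "j < q * m" using ij q by (simp_all add: less_le_trans[of _ m])
  show ?thesis
  proof (rule mdegree_eqI)
    show "coeff (A_poly m q B W $$ (i, j)) d \<noteq> 0"
      unfolding index_A_poly[OF B(1) ij'] using ij W1 by simp
    show "entries_degree_le d (A_poly m q B W)"
      unfolding entries_degree_le_def A
    proof (intro allI impI)
      fix r c assume rc: "r < q * m" "c < q * m"
      note rb = block_index[OF rc(1)] and cb = block_index[OF rc(2)]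
      have "entries_degree_le d (B (r div m + 1))" "entries_degree_le d (W (c div m + 1))"
        using B W rb(3) cb(3) by (force intro: entries_degree_leI less_imp_le)+
      moreover have "B (r div m + 1) \<in> carrier_mat m m" "W (c div m + 1) \<in> carrier_mat m m"
        using B(1) W(1) rb(3) cb(3) by blast+
      ultimately show "degree (A_poly m q B W $$ (r, c)) \<le> d"
        unfolding index_A_poly[OF B(1) rc] using rb(2) cb(2)
        by (intro degree_add_le) (auto simp: entries_degree_leD)
    qed
  qed (use ij' A in simp_all)
qed

lemma rev_mat_A_poly:
  assumes B: "\<forall>i\<in>{1..q}. B i \<in> carrier_mat m m" and W: "\<forall>i\<in>{1..q}. W i \<in> carrier_mat m m"
  shows "rev_mat d (A_poly m q B W) = A_poly m q (\<lambda>i. rev_mat d (B i)) (\<lambda>i. rev_mat d (W i))"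
    (is "_ = ?A'")
proof -
  have B': "\<forall>i\<in>{1..q}. rev_mat d (B i) \<in> carrier_mat m m" using B by simp
  note A = carrier_matD[OF A_poly_carrier]
  show ?thesis
  proof (rule eq_matI)
    fix i j assume "i < dim_row ?A'" "j < dim_col ?A'"
    then have ij: "i < q * m" "j < q * m" using A by simp_all
    note ib = block_index[OF ij(1)] and jb = block_index[OF ij(2)]
    have c: "B (i div m + 1) \<in> carrier_mat m m" "W (j div m + 1) \<in> carrier_mat m m"
      using B W ib(3) jb(3) by blast+
    have "rev_mat d (A_poly m q B W) $$ (i, j) = rev_poly d (A_poly m q B W $$ (i, j))"
      using A ij by (simp add: rev_mat_def)
    also have "\<dots> = ?A' $$ (i, j)"
      unfolding index_A_poly[OF B ij] index_A_poly[OF B' ij]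
      using c ib(2) jb(2) by (auto simp: rev_mat_def rev_poly_add)
    finally show "rev_mat d (A_poly m q B W) $$ (i, j) = ?A' $$ (i, j)" .
  qed (simp_all add: A, simp_all add: rev_mat_def A)
qed

text \<open>Each summand \<open>W i * C i\<close> is reversed at degree \<open>d + d * (q - 1) = d * q\<close>, the same degree as
  the product of all the \<open>B i\<close>, so the reversal of \<open>P\<close> is built from the reversals of the \<open>B i\<close>
  and \<open>W i\<close> in the same way as \<open>P\<close> from the \<open>B i\<close> and \<open>W i\<close>.\<close>
lemma rev_mat_product_plus_sum:
  assumes q: "0 < q"
    and B: "\<forall>i\<in>{1..q}. B i \<in> carrier_mat m m" "\<forall>i\<in>{1..q}. entries_degree_le d (B i)"
    and W: "\<forall>i\<in>{1..q}. W i \<in> carrier_mat m m" "\<forall>i\<in>{1..q}. entries_degree_le d (W i)"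
  shows "rev_mat (d * q) (mprod_list m (map B [1..<Suc q])
      + msum_list m (map (\<lambda>i. W i * cofactor_prod m q B i) [1..<Suc q]))
    = mprod_list m (map (\<lambda>i. rev_mat d (B i)) [1..<Suc q])
      + msum_list m (map (\<lambda>i. rev_mat d (W i) * cofactor_prod m q (\<lambda>i. rev_mat d (B i)) i) [1..<Suc q])"
proof -
  have C: "cofactor_prod m q B i \<in> carrier_mat m m" for i
    unfolding cofactor_prod_def using B by (intro mprod_list_carrier) auto
  have WC: "W i * cofactor_prod m q B i \<in> carrier_mat m m" if "i \<in> {1..q}" for i
    using W C that by (intro mult_carrier_mat[of _ m m]) auto
  have prod: "rev_mat (d * q) (mprod_list m (map B [1..<Suc q]))
      = mprod_list m (map (\<lambda>i. rev_mat d (B i)) [1..<Suc q])"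
    using rev_mat_mprod_list(2)[of "map B [1..<Suc q]" m d] B by (simp add: o_def)
  have summand: "rev_mat (d * q) (W i * cofactor_prod m q B i)
      = rev_mat d (W i) * cofactor_prod m q (\<lambda>i. rev_mat d (B i)) i" if i: "i \<in> {1..q}" for i
  proof -
    let ?js = "filter (\<lambda>j. j \<noteq> i) [1..<Suc q]"
    have "length ?js = card (set ?js)" by (simp only: distinct_card distinct_filter distinct_upt)
    also have "set ?js = {1..q} - {i}" by auto
    finally have len: "length ?js = q - 1" using i by simp
    have js: "\<forall>Q\<in>set (map B ?js). Q \<in> carrier_mat m m \<and> entries_degree_le d Q" using B by auto
    have "d + d * length (map B ?js) = d * q" using q unfolding length_map len by (cases q) simp_all
    then show ?thesis
      using rev_mat_mult[of "W i" m m "cofactor_prod m q B i" m d "d * length (map B ?js)"]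
        rev_mat_mprod_list[OF js] C W i
      by (simp add: cofactor_prod_def o_def)
  qed
  have sum: "rev_mat (d * q) (msum_list m (map (\<lambda>i. W i * cofactor_prod m q B i) [1..<Suc q]))
      = msum_list m (map (\<lambda>i. rev_mat d (W i) * cofactor_prod m q (\<lambda>i. rev_mat d (B i)) i) [1..<Suc q])"
  proof (subst rev_mat_msum_list)
    show "\<forall>Q\<in>set (map (\<lambda>i. W i * cofactor_prod m q B i) [1..<Suc q]). Q \<in> carrier_mat m m"
      using WC by auto
    have "map (rev_mat (d * q)) (map (\<lambda>i. W i * cofactor_prod m q B i) [1..<Suc q])
      = map (\<lambda>i. rev_mat d (W i) * cofactor_prod m q (\<lambda>i. rev_mat d (B i)) i) [1..<Suc q]"
      using summand by simp
    then show "msum_list m (map (rev_mat (d * q)) (map (\<lambda>i. W i * cofactor_prod m q B i) [1..<Suc q]))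
      = msum_list m (map (\<lambda>i. rev_mat d (W i) * cofactor_prod m q (\<lambda>i. rev_mat d (B i)) i) [1..<Suc q])"
      by (rule arg_cong)
  qed
  have "mprod_list m (map B [1..<Suc q]) \<in> carrier_mat m m"
    using B by (intro mprod_list_carrier) auto
  moreover have "msum_list m (map (\<lambda>i. W i * cofactor_prod m q B i) [1..<Suc q]) \<in> carrier_mat m m"
    using WC by (intro msum_list_carrier) auto
  ultimately show ?thesis unfolding prod[symmetric] sum[symmetric] by (rule rev_mat_add)
qed

section \<open>The strong ell-ification\<close>

theorem theorem2p7:
  fixes m n q d :: nat and P :: mat_poly and B W :: "nat \<Rightarrow> mat_poly"
  assumes P_carrier: "P \<in> carrier_mat m m"
    and P_regular: "mregular P"
    and P_degree: "mdegree P = int n"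
    and q: "0 < q" "q \<le> n"
    and B_carrier: "\<forall>i\<in>{1..q}. B i \<in> carrier_mat m m"
    and W_carrier: "\<forall>i\<in>{1..q}. W i \<in> carrier_mat m m"
    and P_eq: "P = mprod_list m (map B [1..<Suc q])
                 + msum_list m (map (\<lambda>i. W i * cofactor_prod m q B i) [1..<Suc q])"
    and B_regular: "\<forall>i\<in>{1..q}. mregular (B i)"
    and B_commute: "\<forall>i\<in>{1..q}. \<forall>j\<in>{1..q}. B i * B j - B j * B i = 0\<^sub>m m m"
    and B_coprime: "\<forall>i\<in>{1..q}. \<forall>j\<in>{1..q}. i \<noteq> j \<longrightarrow> right_coprime m (B i) (B j)"
    and B_degree: "\<forall>i\<in>{1..q}. mdegree (B i) = int d"
    and n_eq: "n = d * q"
    and W_degree: "\<forall>i\<in>{1..q}. mdegree (W i) < mdegree (B i)"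
    and B_rev_coprime: "\<forall>i\<in>{1..q}. \<forall>j\<in>{1..q}. i \<noteq> j \<longrightarrow>
                          right_coprime m (mreversed (B i)) (mreversed (B j))"
  shows "strong_ell_ification m q d (A_poly m q B W) P"
proof -
  let ?B = "\<lambda>i. rev_mat d (B i)" and ?W = "\<lambda>i. rev_mat d (W i)"
  have W_deg: "\<forall>i\<in>{1..q}. mdegree (W i) < int d" using W_degree B_degree by simp
  have B_le: "\<forall>i\<in>{1..q}. entries_degree_le d (B i)"
    using B_degree by (auto intro: entries_degree_leI)
  have W_le: "\<forall>i\<in>{1..q}. entries_degree_le d (W i)"
    using W_deg by (force intro: entries_degree_leI less_imp_le)
  have comm: "B i * B j = B j * B i" if "i \<in> {1..q}" "j \<in> {1..q}" for i j
  proof -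
    have c: "B i \<in> carrier_mat m m" "B j \<in> carrier_mat m m" using B_carrier that by auto
    show ?thesis
    proof (rule eq_matI)
      fix a b assume "a < dim_row (B j * B i)" "b < dim_col (B j * B i)"
      then have ab: "a < m" "b < m" using c by auto
      have "(B i * B j - B j * B i) $$ (a, b) = 0" using B_commute that ab by simp
      then show "(B i * B j) $$ (a, b) = (B j * B i) $$ (a, b)"
        using c ab by (simp del: index_mult_mat(1))
    qed (use c in auto)
  qed
  have rev_comm: "?B i * ?B j = ?B j * ?B i" if "i \<in> {1..q}" "j \<in> {1..q}" for i j
    using rev_mat_mult[of "B i" m m "B j" m d d] rev_mat_mult[of "B j" m m "B i" m d d]
      comm[OF that] B_carrier B_le that by simp
  have rev_coprime: "\<forall>i\<in>{1..q}. \<forall>j\<in>{1..q}. i \<noteq> j \<longrightarrow> right_coprime m (?B i) (?B j)"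
    using B_rev_coprime B_degree by (simp add: mreversed_eq_rev_mat)
  have deg_A: "mdegree (A_poly m q B W) = int d"
    by (rule mdegree_A_poly[OF q(1) B_carrier B_degree W_carrier W_deg])
  have "mequivalent m q (A_poly m q B W) P"
    unfolding P_eq using comm by (intro A_poly_equivalent[OF q(1) B_carrier W_carrier B_regular _ B_coprime]) blast
  moreover have "mequivalent m q (mreversed (A_poly m q B W)) (mreversed P)"
  proof -
    have "mreversed P = rev_mat (d * q) P"
      using P_degree n_eq by (intro mreversed_eq_rev_mat) simp
    also have "\<dots> = mprod_list m (map ?B [1..<Suc q])
        + msum_list m (map (\<lambda>i. ?W i * cofactor_prod m q ?B i) [1..<Suc q])"
      unfolding P_eq by (rule rev_mat_product_plus_sum[OF q(1) B_carrier B_le W_carrier W_le])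
    finally have "mreversed P = \<dots>" .
    moreover have "mreversed (A_poly m q B W) = A_poly m q ?B ?W"
      using rev_mat_A_poly[OF B_carrier W_carrier] deg_A by (simp add: mreversed_eq_rev_mat)
    moreover have "\<forall>i\<in>{1..q}. mregular (?B i)"
      using B_carrier B_le B_regular mregular_rev_mat by blast
    ultimately show ?thesis
      using A_poly_equivalent[of q ?B m ?W] q(1) B_carrier W_carrier rev_comm rev_coprime by simp
  qed
  ultimately show ?thesis
    unfolding strong_ell_ification_def ell_ification_def using deg_A by blast
qed

end
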